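(* Let $n,k$ be integers with $n>4$ and $1\leq k\leq n$. The maximum size $|E(G)|$ of a connected graph $G$ of order $n$ with $mvd(G)=k$ is: $\frac{n(n-1)}{2}-2$ if $k=1$ (and $n\geq 5$); $7$ if $k=2$ and $n=5$; $\frac{n(n-1)}{2}-4$ if $k=2$ and $n\geq 6$; $\frac{n(n-1)}{2}-k+2$ if $3\leq k\leq n-1$; and $\frac{n(n-1)}{2}$ if $k=n$.
   Context: All graphs are finite, simple and undirected. For a vertex-colored graph and two nonadjacent vertices $x,y$, an $x$-$y$ vertex cut is a set $S\subseteq V(G)\setminus\{x,y\}$ such that $x$ and $y$ lie in different components of $G-S$; it is monochromatic if all its vertices have the same color. A vertex-coloring is an MVD-coloring if every pair of nonadjacent vertices has a monochromatic vertex cut separating them. $mvd(G)$ is the maximum number of colors used by an MVD-coloring of $G$. *)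

theory Defs
  imports Main
begin

definition simple_graph :: "'a set \<Rightarrow> 'a set set \<Rightarrow> bool" where
  "simple_graph V E \<longleftrightarrow> finite V \<and> (\<forall>e\<in>E. e \<subseteq> V \<and> card e = 2)"

definition graph_component :: "'a set \<Rightarrow> 'a set set \<Rightarrow> 'a \<Rightarrow> 'a set" where
  "graph_component V E x = {(u, v). u \<in> V \<and> v \<in> V \<and> {u, v} \<in> E}\<^sup>* `` {x}"

definition connected_graph :: "'a set \<Rightarrow> 'a set set \<Rightarrow> bool" where
  "connected_graph V E \<longleftrightarrow>
     simple_graph V E \<and> V \<noteq> {} \<and> (\<forall>x\<in>V. \<forall>y\<in>V. y \<in> graph_component V E x)"

text \<open>The set \<open>{e \<in> E. e \<inter> S = {}}\<close> is the edge set of the graph \<open>G - S\<close>.\<close>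

definition vertex_cut :: "'a set \<Rightarrow> 'a set set \<Rightarrow> 'a \<Rightarrow> 'a \<Rightarrow> 'a set \<Rightarrow> bool" where
  "vertex_cut V E x y S \<longleftrightarrow>
     S \<subseteq> V - {x, y} \<and>
     graph_component (V - S) {e \<in> E. e \<inter> S = {}} x \<noteq> graph_component (V - S) {e \<in> E. e \<inter> S = {}} y"

definition monochromatic :: "('a \<Rightarrow> nat) \<Rightarrow> 'a set \<Rightarrow> bool" where
  "monochromatic c S \<longleftrightarrow> (\<forall>u\<in>S. \<forall>v\<in>S. c u = c v)"

definition MVD_coloring :: "'a set \<Rightarrow> 'a set set \<Rightarrow> ('a \<Rightarrow> nat) \<Rightarrow> bool" where
  "MVD_coloring V E c \<longleftrightarrow>
     (\<forall>x\<in>V. \<forall>y\<in>V. x \<noteq> y \<and> {x, y} \<notin> E \<longrightarrow> (\<exists>S. vertex_cut V E x y S \<and> monochromatic c S))"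

text \<open>For finite \<open>V\<close> the maximum is over a finite nonempty set: the numbers are at most
  \<open>card V\<close>, and every constant coloring is an MVD-coloring, with cuts \<open>V - {x, y}\<close>.\<close>

definition mvd :: "'a set \<Rightarrow> 'a set set \<Rightarrow> nat" where
  "mvd V E = Max {card (c ` V) | c. MVD_coloring V E c}"

end

theory Submission
  imports Defs
begin

text \<open>
  The common neighbors of two nonadjacent vertices \<open>x\<close>, \<open>y\<close> lie in every \<open>x\<close>-\<open>y\<close> cut, so they share one
  color. Each vertex outside \<open>{x, y}\<close> that is not a common neighbor accounts for a nonedge other than
  \<open>{x, y}\<close>; hence a noncomplete graph with \<open>d\<close> nonedges has \<open>mvd \<le> d + 2\<close>, with equality when the
  nonedges form a star with at most \<open>n - 3\<close> edges. If some nonedge \<open>{x, y}\<close> meets every nonedge, giving \<open>x\<close> and \<open>y\<close> private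
  colors and one color to all other vertices shows \<open>mvd \<ge> 3\<close>, since the neighborhoods of \<open>x\<close> and \<open>y\<close> are
  then monochromatic cuts. If there are at most three nonedges and no such dominating one, some nonedge
  is disjoint from all the others, and for \<open>n \<ge> d + 3\<close> this forces \<open>mvd = 1\<close>.
\<close>

section \<open>Nonedges and neighborhoods\<close>

definition nonedges :: "'a set \<Rightarrow> 'a set set \<Rightarrow> 'a set set" where
  "nonedges V E = {e. e \<subseteq> V \<and> card e = 2 \<and> e \<notin> E}"

definition neighbors :: "'a set \<Rightarrow> 'a set set \<Rightarrow> 'a \<Rightarrow> 'a set" where
  "neighbors V E x = {v \<in> V. {x, v} \<in> E}"

lemma nonedgesE:
  assumes "e \<in> nonedges V E"
  obtains x y where "e = {x, y}" "x \<in> V" "y \<in> V" "x \<noteq> y" "{x, y} \<notin> E"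
proof -
  from assms have "card e = 2" "e \<subseteq> V" "e \<notin> E" by (auto simp: nonedges_def)
  then obtain x y where "e = {x, y}" "x \<noteq> y" by (auto simp: card_2_iff)
  with \<open>e \<subseteq> V\<close> \<open>e \<notin> E\<close> show thesis by (intro that) auto
qed

lemma pair_in_nonedges_iff:
  "{x, y} \<in> nonedges V E \<longleftrightarrow> x \<in> V \<and> y \<in> V \<and> x \<noteq> y \<and> {x, y} \<notin> E"
  by (cases "x = y") (auto simp: nonedges_def)

lemma finite_nonedges: "finite V \<Longrightarrow> finite (nonedges V E)"
  by (rule finite_subset[of _ "Pow V"]) (auto simp: nonedges_def)

text \<open>Edges and nonedges partition the two-element subsets of \<open>V\<close>. Maximizing the
  size of a graph thus means minimizing its number of nonedges, which is the form all later bounds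
  take.\<close>

lemma card_edges_plus_nonedges:
  assumes "simple_graph V E"
  shows "card E + card (nonedges V E) = card V * (card V - 1) div 2"
proof -
  have fin: "finite V" using assms by (simp add: simple_graph_def)
  have E: "E \<subseteq> Pow V" using assms by (auto simp: simple_graph_def)
  have "E \<union> nonedges V E = {e. e \<subseteq> V \<and> card e = 2}"
    using assms by (auto simp: simple_graph_def nonedges_def)
  moreover have "card (E \<union> nonedges V E) = card E + card (nonedges V E)"
    using fin E finite_subset[OF E] finite_nonedges[OF fin]
    by (intro card_Un_disjoint) (auto simp: nonedges_def)
  ultimately show ?thesis using n_subsets[OF fin, of 2] by (simp add: choose_two)
qed

section \<open>Components and vertex cuts\<close>

lemma graph_component_refl: "x \<in> graph_component V E x"
  by (simp add: graph_component_def)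

lemma graph_component_eq_if_adjacent:
  assumes "x \<in> V" "y \<in> V" "{x, y} \<in> E"
  shows "graph_component V E x = graph_component V E y"
proof -
  let ?R = "{(u, v). u \<in> V \<and> v \<in> V \<and> {u, v} \<in> E}"
  have "(x, y) \<in> ?R" "(y, x) \<in> ?R" using assms by (auto simp: insert_commute)
  then show ?thesis unfolding graph_component_def
    by (auto intro: converse_rtrancl_into_rtrancl)
qed

lemma graph_component_isolated:
  assumes "\<And>v. v \<in> V \<Longrightarrow> {x, v} \<notin> E"
  shows "graph_component V E x = {x}"
proof -
  have "y = x" if "(x, y) \<in> {(u, v). u \<in> V \<and> v \<in> V \<and> {u, v} \<in> E}\<^sup>*" for y
    using that assms by (cases rule: converse_rtranclE) auto
  then show ?thesis by (auto simp: graph_component_def)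
qed

text \<open>Outside \<open>S\<close>, the vertex \<open>z\<close> would survive together with its
  edges to \<open>x\<close> and \<open>y\<close> and put both into one component of the remaining
  graph.\<close>

lemma common_neighbor_in_vertex_cut:
  assumes "vertex_cut V E x y S" "x \<in> V" "y \<in> V" "z \<in> neighbors V E x" "z \<in> neighbors V E y"
  shows "z \<in> S"
proof (rule ccontr)
  assume "z \<notin> S"
  let ?E = "{e \<in> E. e \<inter> S = {}}"
  have "x \<notin> S" "y \<notin> S" using assms(1) by (auto simp: vertex_cut_def)
  then have "graph_component (V - S) ?E x = graph_component (V - S) ?E z"
    "graph_component (V - S) ?E y = graph_component (V - S) ?E z"
    using assms \<open>z \<notin> S\<close> by (simp_all add: graph_component_eq_if_adjacent neighbors_def)
  then show False using assms(1) by (simp add: vertex_cut_def)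
qed

text \<open>Deleting the neighbors of \<open>x\<close> isolates \<open>x\<close>. Both orders of the
  pair are recorded so that either endpoint of a nonedge can supply the cut.\<close>

lemma vertex_cut_neighbors:
  assumes "simple_graph V E" "{x, y} \<in> nonedges V E"
  shows "vertex_cut V E x y (neighbors V E x)" "vertex_cut V E y x (neighbors V E x)"
proof -
  let ?S = "neighbors V E x"
  let ?E = "{e \<in> E. e \<inter> ?S = {}}"
  have xy: "x \<in> V" "y \<in> V" "x \<noteq> y" "{x, y} \<notin> E"
    using assms(2) by (auto simp: pair_in_nonedges_iff)
  have "{x} \<notin> E" using assms(1) by (auto simp: simple_graph_def)
  then have S: "?S \<subseteq> V - {x, y}" using xy by (auto simp: neighbors_def)
  have "graph_component (V - ?S) ?E x = {x}"
    by (rule graph_component_isolated) (auto simp: neighbors_def)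
  moreover have "y \<in> graph_component (V - ?S) ?E y" by (rule graph_component_refl)
  ultimately have "graph_component (V - ?S) ?E x \<noteq> graph_component (V - ?S) ?E y"
    using xy by auto
  with S show "vertex_cut V E x y ?S" "vertex_cut V E y x ?S"
    by (auto simp: vertex_cut_def)
qed

section \<open>Colors forced by cuts, and colorings obtained from neighborhoods\<close>

lemma common_neighbors_same_color:
  assumes "MVD_coloring V E c" "{x, y} \<in> nonedges V E"
    and "u \<in> neighbors V E x \<inter> neighbors V E y" "v \<in> neighbors V E x \<inter> neighbors V E y"
  shows "c u = c v"
proof -
  have xy: "x \<in> V" "y \<in> V" "x \<noteq> y" "{x, y} \<notin> E"
    using assms(2) by (auto simp: pair_in_nonedges_iff)
  then obtain S where S: "vertex_cut V E x y S" "monochromatic c S"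
    using assms(1) unfolding MVD_coloring_def by blast
  have "u \<in> S" "v \<in> S"
    using common_neighbor_in_vertex_cut[OF S(1) xy(1,2)] assms(3,4) by blast+
  with S(2) show ?thesis unfolding monochromatic_def by blast
qed

text \<open>The neighborhood of either endpoint of a nonedge is a cut, so one monochromatic
  neighborhood per nonedge suffices. Lower bounds on \<open>mvd\<close> above 1 rest on this
  criterion.\<close>

lemma MVD_coloring_if_monochromatic_neighborhoods:
  assumes "simple_graph V E"
    and "\<And>e. e \<in> nonedges V E \<Longrightarrow> \<exists>x\<in>e. monochromatic c (neighbors V E x)"
  shows "MVD_coloring V E c"
  unfolding MVD_coloring_def
proof (intro ballI impI)
  fix x y assume "x \<in> V" "y \<in> V" "x \<noteq> y \<and> {x, y} \<notin> E"
  then have xy: "{x, y} \<in> nonedges V E" and yx: "{y, x} \<in> nonedges V E"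
    by (auto simp: pair_in_nonedges_iff insert_commute)
  from assms(2)[OF xy] vertex_cut_neighbors[OF assms(1) xy] vertex_cut_neighbors[OF assms(1) yx]
  show "\<exists>S. vertex_cut V E x y S \<and> monochromatic c S" by blast
qed

lemma MVD_coloring_const:
  assumes "simple_graph V E"
  shows "MVD_coloring V E (\<lambda>_. a)"
  using assms
  by (rule MVD_coloring_if_monochromatic_neighborhoods) (auto simp: monochromatic_def elim!: nonedgesE)

section \<open>Basic properties of \<open>mvd\<close>\<close>

lemma finite_color_counts:
  assumes "finite V"
  shows "finite {card (c ` V) | c. MVD_coloring V E c}"
  by (rule finite_subset[of _ "{..card V}"]) (auto simp: assms card_image_le)

lemma card_colors_le_mvd:
  assumes "finite V" "MVD_coloring V E c"
  shows "card (c ` V) \<le> mvd V E"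
  unfolding mvd_def using assms by (intro Max_ge finite_color_counts) auto

lemma obtain_mvd_coloring:
  assumes "simple_graph V E"
  obtains c where "MVD_coloring V E c" "card (c ` V) = mvd V E"
proof -
  have "finite V" using assms by (simp add: simple_graph_def)
  moreover have "{card (c ` V) | c. MVD_coloring V E c} \<noteq> {}"
    using MVD_coloring_const[OF assms] by auto
  ultimately have "mvd V E \<in> {card (c ` V) | c. MVD_coloring V E c}"
    unfolding mvd_def by (intro Max_in finite_color_counts)
  then show thesis using that by auto
qed

lemma mvd_le:
  assumes "simple_graph V E" "\<And>c. MVD_coloring V E c \<Longrightarrow> card (c ` V) \<le> m"
  shows "mvd V E \<le> m"
  using obtain_mvd_coloring[OF assms(1)] assms(2) by metis

lemma mvd_le_card:
  assumes "simple_graph V E"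
  shows "mvd V E \<le> card V"
  using assms by (intro mvd_le) (auto simp: card_image_le simple_graph_def)

text \<open>Without nonadjacent pairs there is nothing to separate, so an injective coloring is
  admissible.\<close>

lemma mvd_complete:
  assumes "simple_graph V E" "nonedges V E = {}"
  shows "mvd V E = card V"
proof -
  have fin: "finite V" using assms(1) by (simp add: simple_graph_def)
  then obtain c :: "'a \<Rightarrow> nat" where "inj_on c V"
    using finite_imp_inj_to_nat_seg[of V] by auto
  moreover have "MVD_coloring V E c"
    using assms by (intro MVD_coloring_if_monochromatic_neighborhoods) auto
  ultimately have "card V \<le> mvd V E"
    using card_colors_le_mvd[OF fin] by (metis card_image)
  with mvd_le_card[OF assms(1)] show ?thesis by simp
qed

section \<open>Bounds relating \<open>mvd\<close> to the nonedges\<close>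

text \<open>Each vertex outside \<open>{x, y}\<close> that is not a common neighbor misses an edge
  to \<open>x\<close> or to \<open>y\<close>. Charging it to that nonedge is injective.\<close>

lemma card_common_neighbors_ge:
  assumes "finite V" "{x, y} \<in> nonedges V E"
  shows "card V - 1 \<le> card (neighbors V E x \<inter> neighbors V E y)
    + card {e \<in> nonedges V E. e \<inter> {x, y} \<noteq> {}}"
proof -
  let ?C = "neighbors V E x \<inter> neighbors V E y"
  let ?D = "{e \<in> nonedges V E. e \<inter> {x, y} \<noteq> {}}"
  let ?W = "V - {x, y} - ?C"
  have xy: "x \<in> V" "y \<in> V" "x \<noteq> y" "{x, y} \<notin> E"
    using assms(2) by (auto simp: pair_in_nonedges_iff)
  have finD: "finite ?D" using finite_nonedges[OF assms(1)] by simp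
  \<comment> \<open>\<open>f z\<close> is a nonedge joining \<open>z\<close> to \<open>x\<close> or
    \<open>y\<close>; removing \<open>x\<close> and \<open>y\<close> from it recovers
    \<open>z\<close>.\<close>
  define f where "f z = (if {x, z} \<in> E then {y, z} else {x, z})" for z
  have "inj_on f ?W"
  proof (rule inj_onI)
    fix z w assume "z \<in> ?W" "w \<in> ?W" "f z = f w"
    moreover have "f u - {x, y} = {u}" if "u \<in> ?W" for u using that by (auto simp: f_def)
    ultimately show "z = w" by (metis singleton_inject)
  qed
  moreover have "f ` ?W \<subseteq> ?D - {{x, y}}"
    using xy by (auto simp: f_def pair_in_nonedges_iff neighbors_def doubleton_eq_iff)
  ultimately have "card ?W \<le> card (?D - {{x, y}})"
    using finD by (intro card_inj_on_le) auto
  \<comment> \<open>The nonedge \<open>{x, y}\<close> is never a value of \<open>f\<close>. This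
    spare member of \<open>?D\<close> turns the count of \<open>card V - 2\<close> vertices into the
    bound \<open>card V - 1\<close>.\<close>
  moreover have "{x, y} \<in> ?D" using assms(2) by auto
  then have "card (?D - {{x, y}}) < card ?D"
    using finD by (intro psubset_card_mono) auto
  moreover have "card (V - {x, y}) = card V - 2" "card V \<ge> 2"
    using xy assms(1) card_mono[of V "{x, y}"] by (auto simp: card_Diff_subset)
  moreover have "card (V - {x, y}) \<le> card ?C + card ?W"
  proof -
    have "V - {x, y} \<subseteq> ?C \<union> ?W" by auto
    then have "card (V - {x, y}) \<le> card (?C \<union> ?W)"
      using assms(1) by (intro card_mono) (auto simp: neighbors_def)
    then show ?thesis using card_Un_le[of ?C ?W] by linarith
  qed
  ultimately show ?thesis by linarith
qed

text \<open>With \<open>d\<close> nonedges, the common neighbors of a nonadjacent pair contribute at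
  most one color, and at most \<open>d + 1\<close> vertices are not common neighbors.\<close>

lemma mvd_le_card_nonedges:
  assumes "simple_graph V E" "nonedges V E \<noteq> {}"
  shows "mvd V E \<le> card (nonedges V E) + 2"
proof (rule mvd_le[OF assms(1)])
  fix c assume c: "MVD_coloring V E c"
  have fin: "finite V" using assms(1) by (simp add: simple_graph_def)
  from assms(2) obtain x y where xy: "{x, y} \<in> nonedges V E" by (metis all_not_in_conv nonedgesE)
  let ?C = "neighbors V E x \<inter> neighbors V E y"
  have "card {e \<in> nonedges V E. e \<inter> {x, y} \<noteq> {}} \<le> card (nonedges V E)"
    by (intro card_mono finite_nonedges fin) auto
  with card_common_neighbors_ge[OF fin xy]
  have C: "card V \<le> card ?C + card (nonedges V E) + 1" by linarith
  have subC: "?C \<subseteq> V" by (auto simp: neighbors_def)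
  have "c ` V = c ` (V - ?C) \<union> c ` ?C" using subC by blast
  then have "card (c ` V) \<le> card (c ` (V - ?C)) + card (c ` ?C)"
    using card_Un_le by metis
  also have "card (c ` (V - ?C)) \<le> card V - card ?C"
    using card_image_le[of "V - ?C" c] fin subC card_Diff_subset[of ?C V] finite_subset[OF subC fin] by simp
  also have "card (c ` ?C) \<le> 1"
  proof -
    have "\<forall>a\<in>c ` ?C. \<forall>b\<in>c ` ?C. a = b" using common_neighbors_same_color[OF c xy] by blast
    then show ?thesis
      using finite_subset[OF subC fin] unfolding One_nat_def by (subst card_le_Suc0_iff_eq) blast+
  qed
  finally show "card (c ` V) \<le> card (nonedges V E) + 2" using C by linarith
qed

text \<open>Every nonedge contains an endpoint of \<open>d\<close>, and the neighborhoods of these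
  two endpoints avoid both of them. Hence the endpoints may carry private colors; a third vertex
  carries the common one.\<close>

lemma mvd_ge_3_if_dominating_nonedge:
  assumes "simple_graph V E" "card V \<ge> 3" "d \<in> nonedges V E"
    and "\<And>e. e \<in> nonedges V E \<Longrightarrow> e \<inter> d \<noteq> {}"
  shows "mvd V E \<ge> 3"
proof -
  have fin: "finite V" using assms(1) by (simp add: simple_graph_def)
  from assms(3) obtain x y where d: "d = {x, y}" and xy: "x \<in> V" "y \<in> V" "x \<noteq> y" "{x, y} \<notin> E"
    by (rule nonedgesE)
  have no_loop: "{v} \<notin> E" for v using assms(1) by (auto simp: simple_graph_def)
  define c :: "'a \<Rightarrow> nat" where "c = (\<lambda>v. if v = x then 1 else if v = y then 2 else 0)"
  have "monochromatic c (neighbors V E x)" "monochromatic c (neighbors V E y)"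
    using xy no_loop by (auto simp: monochromatic_def neighbors_def c_def insert_commute)
  then have "MVD_coloring V E c"
    using assms(1,4) d by (intro MVD_coloring_if_monochromatic_neighborhoods) blast+
  then have "card (c ` V) \<le> mvd V E" by (rule card_colors_le_mvd[OF fin])
  moreover have "\<not> V \<subseteq> {x, y}" using assms(2) xy card_mono[of "{x, y}" V] by auto
  then obtain z where "z \<in> V" "z \<noteq> x" "z \<noteq> y" by auto
  then have "{0, 1, 2} \<subseteq> c ` V"
    using xy by (auto simp: c_def image_iff intro: bexI[of _ x] bexI[of _ y] bexI[of _ z])
  then have "card {0, 1, 2 :: nat} \<le> card (c ` V)" using fin by (intro card_mono) auto
  ultimately show ?thesis by simp
qed

text \<open>If \<open>mvd\<close> were 2, some nonedge \<open>e\<close> would be disjoint from all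
  others. The vertices outside \<open>e\<close> are then common neighbors of its endpoints and share
  a color. A second nonedge \<open>f\<close> has both endpoints of \<open>e\<close> and some vertex
  outside \<open>e\<close> as common neighbors, which leaves a single color.\<close>

lemma mvd_neq_2_if_few_nonedges:
  assumes sg: "simple_graph V E" and few: "card (nonedges V E) \<le> 3" "card (nonedges V E) + 3 \<le> card V"
  shows "mvd V E \<noteq> 2"
proof
  assume mvd2: "mvd V E = 2"
  let ?N = "nonedges V E"
  have fin: "finite V" using sg by (simp add: simple_graph_def)
  note finN = finite_nonedges[OF fin, of E]
  have ne: "?N \<noteq> {}" using mvd_complete[OF sg] mvd2 few by auto
  \<comment> \<open>Otherwise \<open>e\<close> meets every nonedge and \<open>mvd\<close> is at
    least 3.\<close>
  have disj: "\<exists>f\<in>?N. f \<inter> e = {}" if "e \<in> ?N" for e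
    using mvd_ge_3_if_dominating_nonedge[OF sg _ that] mvd2 few by fastforce
  have nonempty: "e \<noteq> {}" if "e \<in> ?N" for e using that by (auto simp: nonedges_def)
  \<comment> \<open>If every nonedge meets another one, take \<open>f\<close> disjoint from
    \<open>e\<close> and \<open>g\<close> meeting \<open>e\<close>. These are all the nonedges, so
    \<open>f\<close> must meet \<open>g\<close>; then \<open>g\<close> meets every nonedge, against
    \<open>disj\<close>.\<close>
  have "\<exists>e\<in>?N. \<forall>f\<in>?N - {e}. e \<inter> f = {}"
  proof (rule ccontr)
    assume "\<not> ?thesis"
    then have meet: "\<exists>f\<in>?N. f \<noteq> e \<and> e \<inter> f \<noteq> {}" if "e \<in> ?N" for e using that by blast
    obtain e where e: "e \<in> ?N" using ne by auto
    obtain f where f: "f \<in> ?N" "f \<inter> e = {}" using disj[OF e] by auto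
    obtain g where g: "g \<in> ?N" "g \<noteq> e" "e \<inter> g \<noteq> {}" using meet[OF e] by auto
    have "f \<noteq> e" "f \<noteq> g" using f g nonempty[OF e] by auto
    then have "card {e, f, g} = 3" using g by auto
    then have N: "?N = {e, f, g}"
      using few(1) e f(1) g(1) by (intro card_seteq[symmetric] finN) auto
    have "f \<inter> g \<noteq> {}" using meet[OF f(1)] f(2) unfolding N by auto
    moreover obtain h where "h \<in> ?N" "h \<inter> g = {}" using disj[OF g(1)] by auto
    ultimately show False using g nonempty[OF g(1)] unfolding N by auto
  qed
  then obtain e where e: "e \<in> ?N" and iso: "\<And>f. f \<in> ?N \<Longrightarrow> f \<noteq> e \<Longrightarrow> e \<inter> f = {}" by blast
  obtain f where f: "f \<in> ?N" "f \<inter> e = {}" using disj[OF e] by auto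
  obtain p q where pq: "e = {p, q}" "p \<in> V" "q \<in> V" "p \<noteq> q" using e by (metis nonedgesE)
  obtain a b where ab: "f = {a, b}" "a \<in> V" "b \<in> V" "a \<noteq> b" using f(1) by (metis nonedgesE)
  let ?C = "neighbors V E a \<inter> neighbors V E b"
  obtain c where c: "MVD_coloring V E c" "card (c ` V) = 2"
    using obtain_mvd_coloring[OF sg] mvd2 by metis
  \<comment> \<open>A missing edge from \<open>e\<close> to the outside would be another nonedge
    meeting \<open>e\<close>.\<close>
  have full: "{u, v} \<in> E" if "u \<in> e" "v \<in> V" "v \<notin> e" for u v
  proof (rule ccontr)
    assume "{u, v} \<notin> E"
    then have "{u, v} \<in> ?N" using that pq by (auto simp: pair_in_nonedges_iff)
    then show False using iso[of "{u, v}"] that by auto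
  qed
  \<comment> \<open>Since \<open>e\<close> itself misses \<open>{a, b}\<close>, the count of
    nonedges at \<open>a\<close> or \<open>b\<close> drops by one. This yields three common
    neighbors, hence one, \<open>w\<close>, outside the two-element set \<open>e\<close>.\<close>
  have "{e \<in> ?N. e \<inter> {a, b} \<noteq> {}} \<subset> ?N" using e f ab by blast
  then have "card {e \<in> ?N. e \<inter> {a, b} \<noteq> {}} < card ?N" by (rule psubset_card_mono[OF finN])
  then have "card ?C \<ge> 3"
    using card_common_neighbors_ge[OF fin, of a b E] f(1) ab few by simp
  then have "\<not> ?C \<subseteq> {p, q}" using card_mono[of "{p, q}" ?C] pq by auto
  then obtain w where w: "w \<in> ?C" "w \<notin> e" using pq by auto
  have "c v = c w" if "v \<in> V" for v
  proof (cases "v \<in> e")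
    case True
    then have "v \<in> ?C"
      using full[of v a] full[of v b] f ab that by (auto simp: neighbors_def insert_commute)
    then show ?thesis
      using common_neighbors_same_color[OF c(1) _ _ w(1)] f(1) ab by metis
  next
    case False
    then have "v \<in> neighbors V E p \<inter> neighbors V E q" "w \<in> neighbors V E p \<inter> neighbors V E q"
      using full w that pq by (auto simp: neighbors_def)
    then show ?thesis using common_neighbors_same_color[OF c(1)] e pq by metis
  qed
  then have "c ` V \<subseteq> {c w}" by auto
  then have "card (c ` V) \<le> 1" using card_mono[of "{c w}" "c ` V"] by simp
  with c(2) show False by simp
qed

text \<open>With no nonedge, \<open>mvd\<close> is \<open>card V\<close>; a single nonedge meets
  itself and so is dominating. Either way \<open>mvd\<close> is at least 3.\<close>

lemma mvd_1_imp_two_le_card_nonedges: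
  assumes "simple_graph V E" "mvd V E = 1" "card V \<ge> 3"
  shows "card (nonedges V E) \<ge> 2"
proof (rule ccontr)
  assume "\<not> ?thesis"
  moreover have fin: "finite V" using assms(1) by (simp add: simple_graph_def)
  moreover have "nonedges V E \<noteq> {}" using mvd_complete[OF assms(1)] assms by auto
  ultimately have "card (nonedges V E) = 1"
    using finite_nonedges[OF fin, of E] card_gt_0_iff[of "nonedges V E"] by linarith
  then obtain d where d: "nonedges V E = {d}" by (auto simp: card_1_singleton_iff)
  then have "d \<in> nonedges V E" by simp
  moreover from this have "d \<noteq> {}" by (auto simp: nonedges_def)
  ultimately have "mvd V E \<ge> 3"
    using d assms by (intro mvd_ge_3_if_dominating_nonedge) auto
  then show False using assms by simp
qed

section \<open>Graphs prescribed by their nonedges\<close>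

text \<open>The formula is that of \<open>nonedges\<close>, read in the other direction:
  \<open>F\<close> is the intended set of nonedges and the result is the edge set.\<close>

definition co_graph :: "'a set \<Rightarrow> 'a set set \<Rightarrow> 'a set set" where
  "co_graph V F = {e. e \<subseteq> V \<and> card e = 2 \<and> e \<notin> F}"

lemma simple_co_graph: "finite V \<Longrightarrow> simple_graph V (co_graph V F)"
  by (auto simp: simple_graph_def co_graph_def)

lemma pair_in_co_graph_iff:
  "{x, y} \<in> co_graph V F \<longleftrightarrow> x \<in> V \<and> y \<in> V \<and> x \<noteq> y \<and> {x, y} \<notin> F"
  by (cases "x = y") (auto simp: co_graph_def)

lemma in_neighbors_co_graph_iff:
  "v \<in> neighbors V (co_graph V F) x \<longleftrightarrow> v \<in> V \<and> x \<in> V \<and> x \<noteq> v \<and> {x, v} \<notin> F"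
  by (auto simp: neighbors_def pair_in_co_graph_iff)

lemma nonedges_co_graph:
  assumes "\<And>e. e \<in> F \<Longrightarrow> e \<subseteq> V \<and> card e = 2"
  shows "nonedges V (co_graph V F) = F"
  using assms by (auto simp: nonedges_def co_graph_def)

text \<open>Being a common neighbor is rephrased as the absence of four pairs from \<open>F\<close>,
  which simplification can check for a concrete \<open>F\<close>.\<close>

lemma co_graph_same_color:
  assumes "MVD_coloring V (co_graph V F) c" "{x, y} \<in> F" "u \<in> V" "v \<in> V" "x \<in> V" "y \<in> V" "x \<noteq> y"
    and "u \<notin> {x, y}" "v \<notin> {x, y}" "{{x, u}, {y, u}, {x, v}, {y, v}} \<inter> F = {}"
  shows "c u = c v"
  using assms(2-)
  by (intro common_neighbors_same_color[OF assms(1), of x y])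
    (auto simp: pair_in_nonedges_iff pair_in_co_graph_iff in_neighbors_co_graph_iff)

lemma card_co_graph:
  assumes "finite V" "\<And>e. e \<in> F \<Longrightarrow> e \<subseteq> V \<and> card e = 2"
  shows "card (co_graph V F) = card V * (card V - 1) div 2 - card F"
  using card_edges_plus_nonedges[OF simple_co_graph[OF assms(1), of F]] nonedges_co_graph[of F V] assms(2) by simp

lemma connected_graphI:
  assumes "simple_graph V E" "u \<in> V" "\<And>v. v \<in> V \<Longrightarrow> graph_component V E v = graph_component V E u"
  shows "connected_graph V E"
proof -
  have "y \<in> graph_component V E x" if "x \<in> V" "y \<in> V" for x y
    using assms(3)[OF that(1)] assms(3)[OF that(2)] graph_component_refl[of y V E] by simp
  then show ?thesis using assms(1,2) unfolding connected_graph_def by blast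
qed

text \<open>A vertex that lies on no nonedge is adjacent to all others.\<close>

lemma connected_co_graph:
  assumes "finite V" "u \<in> V" "u \<notin> \<Union> F"
  shows "connected_graph V (co_graph V F)"
proof (rule connected_graphI[OF simple_co_graph[OF assms(1)] assms(2)])
  fix v assume v: "v \<in> V"
  show "graph_component V (co_graph V F) v = graph_component V (co_graph V F) u"
  proof (cases "v = u")
    case False
    have "{v, u} \<notin> F" using assms(3) by auto
    then show ?thesis
      using False v assms(2) by (intro graph_component_eq_if_adjacent) (simp_all add: pair_in_co_graph_iff)
  qed simp
qed

section \<open>Extremal graphs\<close>

text \<open>The nonedges are two disjoint pairs. Each pair forces one color on all vertices outside
  it, and vertex 4, outside both, links the two classes.\<close>

lemma extremal_1:
  fixes n :: nat
  assumes "n \<ge> 5"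
  shows "\<exists>(V :: nat set) E. connected_graph V E \<and> card V = n \<and> mvd V E = 1 \<and>
    card E = n * (n - 1) div 2 - 2"
proof -
  define F :: "nat set set" where "F = {{0, 1}, {2, 3}}"
  let ?V = "{..<n}" and ?E = "co_graph {..<n} F"
  have F: "e \<subseteq> ?V \<and> card e = 2" if "e \<in> F" for e using that assms by (auto simp: F_def)
  have sg: "simple_graph ?V ?E" by (simp add: simple_co_graph)
  have "mvd ?V ?E \<le> 1"
  proof (rule mvd_le[OF sg])
    fix c assume c: "MVD_coloring ?V ?E c"
    have "c v = c 4" if "v < n" for v
    proof (cases "v = 0 \<or> v = 1")
      case True
      then show ?thesis using assms
        by (intro co_graph_same_color[OF c, of 2 3]) (auto simp: F_def doubleton_eq_iff)
    next
      case False
      then show ?thesis using assms that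
        by (intro co_graph_same_color[OF c, of 0 1]) (auto simp: F_def doubleton_eq_iff)
    qed
    then have "c ` ?V \<subseteq> {c 4}" by auto
    then show "card (c ` ?V) \<le> 1" using card_mono[of "{c 4}" "c ` ?V"] by simp
  qed
  moreover have "card ((\<lambda>_. 0 :: nat) ` ?V) \<le> mvd ?V ?E"
    by (intro card_colors_le_mvd MVD_coloring_const sg) simp
  then have "mvd ?V ?E \<ge> 1" using assms by (simp add: image_constant_conv lessThan_empty_iff split: if_splits)
  moreover have "card F = 2" by (auto simp: F_def doubleton_eq_iff)
  moreover have "connected_graph ?V ?E"
    using assms by (intro connected_co_graph[of _ 4]) (auto simp: F_def)
  ultimately show ?thesis using card_co_graph[of ?V F, OF _ F] by (intro exI[of _ ?V] exI[of _ ?E]) simp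
qed

text \<open>The nonedges form the path 0-1-2 and the pair 3-4. The pair forces one color on the
  path, and the nonedge \<open>{0, 1}\<close> forces one color on the pair; nothing links the two
  because no fifth-order vertex lies outside all nonedges.\<close>

lemma extremal_2_5:
  "\<exists>(V :: nat set) E. connected_graph V E \<and> card V = 5 \<and> mvd V E = 2 \<and> card E = 7"
proof -
  define F :: "nat set set" where "F = {{0, 1}, {1, 2}, {3, 4}}"
  let ?V = "{..<5 :: nat}" and ?E = "co_graph {..<5} F"
  have F: "e \<subseteq> ?V \<and> card e = 2" if "e \<in> F" for e using that by (auto simp: F_def)
  note N = nonedges_co_graph[of F ?V, OF F]
  have sg: "simple_graph ?V ?E" by (simp add: simple_co_graph)
  have V: "?V = {0, 1, 2, 3, 4}" by (auto simp: numeral_eq_Suc less_Suc_eq)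
  have "mvd ?V ?E \<le> 2"
  proof (rule mvd_le[OF sg])
    fix c assume c: "MVD_coloring ?V ?E c"
    have "c 3 = c 4"
      by (rule co_graph_same_color[OF c, of 0 1]) (auto simp: F_def doubleton_eq_iff)
    moreover have "c 1 = c 0"
      by (rule co_graph_same_color[OF c, of 3 4]) (auto simp: F_def doubleton_eq_iff)
    moreover have "c 2 = c 0"
      by (rule co_graph_same_color[OF c, of 3 4]) (auto simp: F_def doubleton_eq_iff)
    ultimately have "c ` ?V \<subseteq> {c 0, c 4}" by (auto simp: V)
    then show "card (c ` ?V) \<le> 2" using card_mono[of "{c 0, c 4}" "c ` ?V"] card_insert_le_m1[of 2 "{c 4}" "c 0"] by simp
  qed
  moreover have "mvd ?V ?E \<ge> 2"
  proof -
    let ?c = "\<lambda>v :: nat. if v < 3 then 0 else 1 :: nat"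
    have "monochromatic ?c (neighbors ?V ?E 1)" "monochromatic ?c (neighbors ?V ?E 3)"
      by (auto simp: monochromatic_def in_neighbors_co_graph_iff F_def doubleton_eq_iff)
    then have "MVD_coloring ?V ?E ?c"
      by (intro MVD_coloring_if_monochromatic_neighborhoods[OF sg]) (auto simp: N, auto simp: F_def)
    from card_colors_le_mvd[OF _ this] show ?thesis by (simp add: V)
  qed
  moreover have "card F = 3" by (auto simp: F_def doubleton_eq_iff)
  moreover have "connected_graph ?V ?E"
  proof (rule connected_graphI[OF sg, of 0])
    have adj: "graph_component ?V ?E u = graph_component ?V ?E v" if "{u, v} \<notin> F" "u \<noteq> v" "u < 5" "v < 5" for u v
      using that by (intro graph_component_eq_if_adjacent) (auto simp: pair_in_co_graph_iff)
    fix v assume "v \<in> ?V"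
    then show "graph_component ?V ?E v = graph_component ?V ?E 0"
      \<comment> \<open>Vertex 0 is adjacent to all others except 1, which is reached through
        3.\<close>
      using adj[of 1 3] adj[of 3 0] adj[of 2 0] adj[of 4 0] by (auto simp: V F_def doubleton_eq_iff)
  qed simp
  ultimately show ?thesis using card_co_graph[of ?V F, OF _ F] by (intro exI[of _ ?V] exI[of _ ?E]) simp
qed

text \<open>The nonedges form the path 0-1-2-3-4. Its two end pairs force one color on all vertices
  but 2. The middle vertex 2 is free, since the neighborhoods of 1 and 3 avoid it and every nonedge
  contains 1 or 3.\<close>

lemma extremal_2:
  fixes n :: nat
  assumes "n \<ge> 6"
  shows "\<exists>(V :: nat set) E. connected_graph V E \<and> card V = n \<and> mvd V E = 2 \<and>
    card E = n * (n - 1) div 2 - 4"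
proof -
  define F :: "nat set set" where "F = {{0, 1}, {1, 2}, {2, 3}, {3, 4}}"
  let ?V = "{..<n}" and ?E = "co_graph {..<n} F"
  have F: "e \<subseteq> ?V \<and> card e = 2" if "e \<in> F" for e using that assms by (auto simp: F_def)
  note N = nonedges_co_graph[of F ?V, OF F]
  have sg: "simple_graph ?V ?E" by (simp add: simple_co_graph)
  have "mvd ?V ?E \<le> 2"
  proof (rule mvd_le[OF sg])
    fix c assume c: "MVD_coloring ?V ?E c"
    have "c v = c 5" if "v < n" "v \<noteq> 2" for v
    proof (cases "v = 0 \<or> v = 1")
      case True
      then show ?thesis using assms
        by (intro co_graph_same_color[OF c, of 3 4]) (auto simp: F_def doubleton_eq_iff)
    next
      case False
      then show ?thesis using assms that
        by (intro co_graph_same_color[OF c, of 0 1]) (auto simp: F_def doubleton_eq_iff)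
    qed
    then have "c ` ?V \<subseteq> {c 2, c 5}" by auto
    then show "card (c ` ?V) \<le> 2" using card_mono[of "{c 2, c 5}" "c ` ?V"] card_insert_le_m1[of 2 "{c 5}" "c 2"] by simp
  qed
  moreover have "mvd ?V ?E \<ge> 2"
  proof -
    let ?c = "\<lambda>v :: nat. if v = 2 then 0 else 1 :: nat"
    have "monochromatic ?c (neighbors ?V ?E 1)" "monochromatic ?c (neighbors ?V ?E 3)"
      by (auto simp: monochromatic_def in_neighbors_co_graph_iff F_def doubleton_eq_iff)
    then have "MVD_coloring ?V ?E ?c"
      by (intro MVD_coloring_if_monochromatic_neighborhoods[OF sg]) (auto simp: N, auto simp: F_def)
    then have "card (?c ` ?V) \<le> mvd ?V ?E" by (rule card_colors_le_mvd[rotated]) simp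
    moreover have "?c ` {0, 2} \<subseteq> ?c ` ?V" using assms by (intro image_mono) auto
    then have "card {0, 1 :: nat} \<le> card (?c ` ?V)" by (intro card_mono) auto
    ultimately show ?thesis by simp
  qed
  moreover have "card F = 4" by (auto simp: F_def doubleton_eq_iff)
  moreover have "connected_graph ?V ?E"
    using assms by (intro connected_co_graph[of _ 5]) (auto simp: F_def)
  ultimately show ?thesis using card_co_graph[of ?V F, OF _ F] by (intro exI[of _ ?V] exI[of _ ?E]) simp
qed

text \<open>The nonedges form a star with center 0 and \<open>k - 2\<close> leaves, so the general
  upper bound on \<open>mvd\<close> is exactly \<open>k\<close>. Center and leaves lie outside the
  neighborhood of 0 and may have private colors.\<close>

lemma extremal_star:
  fixes n k :: nat
  assumes "3 \<le> k" "k < n"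
  shows "\<exists>(V :: nat set) E. connected_graph V E \<and> card V = n \<and> mvd V E = k \<and>
    card E = n * (n - 1) div 2 - (k - 2)"
proof -
  define F :: "nat set set" where "F = (\<lambda>i. {0, i}) ` {1..k - 2}"
  let ?V = "{..<n}" and ?E = "co_graph {..<n} F"
  have F: "e \<subseteq> ?V \<and> card e = 2" if "e \<in> F" for e using that assms by (auto simp: F_def)
  note N = nonedges_co_graph[of F ?V, OF F]
  have sg: "simple_graph ?V ?E" by (simp add: simple_co_graph)
  have "inj_on (\<lambda>i :: nat. {0, i}) {1..k - 2}" by (auto simp: inj_on_def doubleton_eq_iff)
  then have cF: "card F = k - 2" unfolding F_def by (simp add: card_image)
  then have "F \<noteq> {}" using assms by auto
  then have "mvd ?V ?E \<le> k" using mvd_le_card_nonedges[OF sg] assms N cF by simp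
  moreover have "mvd ?V ?E \<ge> k"
  proof -
    \<comment> \<open>The center and the leaves are the numbers below \<open>k - 1\<close> and keep
      distinct colors; all neighbors of 0 receive color \<open>k - 1\<close>.\<close>
    let ?c = "\<lambda>v :: nat. min v (k - 1)"
    have "{0, v} \<in> F" if "0 < v" "v < k - 1" for v using that assms by (auto simp: F_def)
    then have "k - 1 \<le> v" if "v \<in> neighbors ?V ?E 0" for v
      using that by (metis in_neighbors_co_graph_iff not_le bot_nat_0.not_eq_extremum)
    then have "monochromatic ?c (neighbors ?V ?E 0)"
      by (auto simp: monochromatic_def min_absorb2)
    then have "MVD_coloring ?V ?E ?c"
      by (intro MVD_coloring_if_monochromatic_neighborhoods[OF sg]) (auto simp: N, auto simp: F_def)
    then have "card (?c ` ?V) \<le> mvd ?V ?E" by (rule card_colors_le_mvd[rotated]) simp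
    moreover have "{..<k} \<subseteq> ?c ` ?V"
    proof
      fix v assume "v \<in> {..<k}"
      then show "v \<in> ?c ` ?V" using assms by (intro image_eqI[of _ _ v]) auto
    qed
    then have "card {..<k} \<le> card (?c ` ?V)" by (intro card_mono) auto
    ultimately show ?thesis by simp
  qed
  moreover have "connected_graph ?V ?E"
    \<comment> \<open>The last vertex \<open>n - 1\<close> lies outside the star because
      \<open>k - 2 < n - 1\<close>.\<close>
    using assms by (intro connected_co_graph[of _ "n - 1"]) (auto simp: F_def)
  ultimately show ?thesis using card_co_graph[of ?V F, OF _ F] cF by (intro exI[of _ ?V] exI[of _ ?E]) simp
qed

lemma extremal_complete:
  fixes n :: nat
  assumes "n > 0"
  shows "\<exists>(V :: nat set) E. connected_graph V E \<and> card V = n \<and> mvd V E = n \<and>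
    card E = n * (n - 1) div 2"
proof -
  let ?V = "{..<n}" and ?E = "co_graph {..<n} {}"
  have "mvd ?V ?E = n" using mvd_complete[of ?V ?E] nonedges_co_graph[of "{}" ?V] by (simp add: simple_co_graph)
  moreover have "connected_graph ?V ?E" using assms by (intro connected_co_graph[of _ 0]) auto
  ultimately show ?thesis using card_co_graph[of ?V "{}"] by (intro exI[of _ ?V] exI[of _ ?E]) auto
qed

section \<open>The maximum size for each value of \<open>mvd\<close>\<close>

text \<open>The extremal graphs live on \<open>nat\<close>, since an arbitrary type
  \<open>'a\<close> may have fewer than \<open>n\<close> elements; the upper bound holds over every
  vertex type.\<close>

theorem theorem1p5:
  fixes n k :: nat
  assumes "n > 4" and "1 \<le> k" and "k \<le> n"
  shows "let m = (if k = 1 then n * (n - 1) div 2 - 2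
                  else if k = 2 \<and> n = 5 then 7
                  else if k = 2 then n * (n - 1) div 2 - 4
                  else if k \<le> n - 1 then n * (n - 1) div 2 - k + 2
                  else n * (n - 1) div 2)
         in (\<exists>(V :: nat set) E. connected_graph V E \<and> card V = n \<and> mvd V E = k \<and> card E = m) \<and>
            (\<forall>(V :: 'a set) E. connected_graph V E \<and> card V = n \<and> mvd V E = k \<longrightarrow> card E \<le> m)"
proof -
  define M where "M = n * (n - 1) div 2"
  \<comment> \<open>This gives \<open>2 * n \<le> M\<close>, so that the subtraction in
    \<open>M - k + 2\<close> is not truncated.\<close>
  have "n * 4 \<le> n * (n - 1)" using assms(1) by (intro mult_le_mono) auto
  then have "n * 4 div 2 \<le> M" unfolding M_def by (rule div_le_mono)
  then have M: "2 * n \<le> M" by simp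
  define m where "m = (if k = 1 then M - 2
                  else if k = 2 \<and> n = 5 then 7
                  else if k = 2 then M - 4
                  else if k \<le> n - 1 then M - k + 2
                  else M)"
  have "\<exists>(V :: nat set) E. connected_graph V E \<and> card V = n \<and> mvd V E = k \<and> card E = m"
  proof -
    consider "k = 1" | "k = 2" "n = 5" | "k = 2" "n \<ge> 6" | "3 \<le> k" "k < n" | "k = n"
      using assms by linarith
    then show ?thesis
    proof cases
      case 1 then show ?thesis using extremal_1[of n] assms by (simp add: m_def M_def)
    next
      case 2 then show ?thesis using extremal_2_5 by (simp add: m_def)
    next
      case 3 then show ?thesis using extremal_2[of n] by (simp add: m_def M_def)
    next
      case 4
      then have "m = M - k + 2" by (auto simp: m_def)
      also have "\<dots> = M - (k - 2)" using 4 M by linarith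
      finally have "m = M - (k - 2)" .
      then show ?thesis using extremal_star[OF 4] by (simp add: M_def)
    next
      case 5
      then have "\<not> k \<le> n - 1" "k \<noteq> 1" "k \<noteq> 2" using assms by linarith+
      then have "m = M" by (simp add: m_def)
      then show ?thesis using extremal_complete[of n] 5 assms by (simp add: M_def)
    qed
  qed
  moreover have "card E \<le> m" if "connected_graph V E" "card V = n" "mvd V E = k" for V :: "'a set" and E
  proof -
    have sg: "simple_graph V E" using that(1) by (simp add: connected_graph_def)
    have eq: "card E + card (nonedges V E) = M"
      using card_edges_plus_nonedges[OF sg] that by (simp add: M_def)
    have ne: "nonedges V E \<noteq> {}" if "k < n" using mvd_complete[OF sg] that \<open>mvd V E = k\<close> \<open>card V = n\<close> by auto
    consider "k = 1" | "k = 2" "n = 5" | "k = 2" "n \<ge> 6" | "3 \<le> k" "k < n" | "k = n"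
      using assms by linarith
    then show ?thesis
    proof cases
      case 1
      then show ?thesis using mvd_1_imp_two_le_card_nonedges[OF sg] that assms eq by (simp add: m_def)
    next
      case 2
      then have "M = 10" "m = 7" by (simp_all add: M_def m_def)
      \<comment> \<open>Excluding \<open>mvd = 2\<close> requires three more vertices than nonedges,
        so five vertices rule out only up to two nonedges; six or more rule out three as
        well.\<close>
      moreover have "\<not> card (nonedges V E) \<le> 2" using mvd_neq_2_if_few_nonedges[OF sg] that 2 by auto
      ultimately show ?thesis using eq by linarith
    next
      case 3
      then have "m = M - 4" by (simp add: m_def)
      moreover have "\<not> card (nonedges V E) \<le> 3" using mvd_neq_2_if_few_nonedges[OF sg] that 3 by auto
      ultimately show ?thesis using eq by linarith
    next
      case 4
      then have "m = M - k + 2" by (auto simp: m_def)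
      moreover have "k \<le> card (nonedges V E) + 2" using mvd_le_card_nonedges[OF sg ne] 4 that by simp
      ultimately show ?thesis using eq by linarith
    next
      case 5
      then have "\<not> k \<le> n - 1" "k \<noteq> 1" "k \<noteq> 2" using assms by linarith+
      then show ?thesis using eq by (simp add: m_def)
    qed
  qed
  ultimately show ?thesis unfolding Let_def m_def M_def by blast
qed

end
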